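(* Let $\mathcal{M}=\{p_\theta:\theta\in\Theta\}$ be a regular statistical model with Fisher-Rao distance $\rho$, let $\theta_0\neq\theta_1$ in $\Theta$, let $\gamma:[0,1]\to\Theta$ be a constant-speed length-minimizing Fisher-Rao geodesic from $\theta_0$ to $\theta_1$, and let $\rho_L,\rho_U:\Theta\times\Theta\to[0,\infty)$ be lower and upper bounds, $\rho_L(\theta,\theta')\leq\rho(\theta,\theta')\leq\rho_U(\theta,\theta')$, that are tight at infinitesimal scale. Let $\epsilon>0$. Consider the recursive procedure $\mathrm{ApproxFisherRao}(\theta_0,\theta_1,\epsilon)$: if $\rho_U(\theta_0,\theta_1)>(1+\epsilon)\,\rho_L(\theta_0,\theta_1)$, return $2\times\mathrm{ApproxFisherRao}(\theta_0,\gamma(\tfrac12),\epsilon)$, where the geodesic from $\theta_0$ to $\gamma(\tfrac12)$ used in the recursive call is the first half of $\gamma$; otherwise return $\rho_U(\theta_0,\theta_1)$. Then the procedure terminates and its output $\tilde\rho_\epsilon(\theta_0,\theta_1)$ satisfies $$\rho(\theta_0,\theta_1)\leq\tilde\rho_\epsilon(\theta_0,\theta_1)\leq(1+\epsilon)\,\rho(\theta_0,\theta_1).$$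
   Context: A regular statistical model is a family of probability densities $p_\theta$ indexed by $\theta$ in a connected open set $\Theta\subset\mathbb{R}^m$, whose Fisher information matrix $I(\theta)$ is well defined, positive-definite and smooth. The Fisher-Rao distance $\rho$ is the Riemannian distance of the metric $I(\theta)$ on $\Theta$. A constant-speed minimizing geodesic satisfies $\rho(\gamma(s),\gamma(t))=|s-t|\,\rho(\theta_0,\theta_1)$. The bounds $\rho_L,\rho_U$ are called tight at infinitesimal scale if for every $\eta>0$ every point of $\Theta$ has a neighborhood in which all pairs of distinct points $\theta,\theta'$ satisfy $\rho_U(\theta,\theta')\leq(1+\eta)\,\rho_L(\theta,\theta')$. *)

theory Defs
  imports "HOL-Probability.Probability"
begin

text \<open>A function is \<open>C\<^sup>k\<close> on an open set when it is differentiable there and all its directional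
  derivatives are \<open>C\<^sup>k\<^sup>-\<^sup>1\<close>; in finite dimension this is equivalent to continuity of all partial
  derivatives up to order \<open>k\<close>.\<close>

primrec Ck_on :: "'a::euclidean_space set \<Rightarrow> ('a \<Rightarrow> 'b::real_normed_vector) \<Rightarrow> nat \<Rightarrow> bool" where
  "Ck_on S f 0 \<longleftrightarrow> continuous_on S f"
| "Ck_on S f (Suc k) \<longleftrightarrow>
     (\<forall>x\<in>S. f differentiable (at x)) \<and> (\<forall>v. Ck_on S (\<lambda>x. frechet_derivative f (at x) v) k)"

definition smooth_on :: "'a::euclidean_space set \<Rightarrow> ('a \<Rightarrow> 'b::real_normed_vector) \<Rightarrow> bool" where
  "smooth_on S f \<longleftrightarrow> (\<forall>k. Ck_on S f k)"

definition positive_definite :: "real^'m^'m \<Rightarrow> bool" where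
  "positive_definite A \<longleftrightarrow> transpose A = A \<and> (\<forall>v. v \<noteq> 0 \<longrightarrow> v \<bullet> (A *v v) > 0)"

definition model_measure :: "'x measure \<Rightarrow> (real^'m \<Rightarrow> 'x \<Rightarrow> real) \<Rightarrow> real^'m \<Rightarrow> 'x measure" where
  "model_measure M p \<theta> = density M (\<lambda>x. ennreal (p \<theta> x))"

definition score :: "(real^'m \<Rightarrow> 'x \<Rightarrow> real) \<Rightarrow> real^'m \<Rightarrow> 'm::finite \<Rightarrow> 'x \<Rightarrow> real" where
  "score p \<theta> i x = frechet_derivative (\<lambda>\<theta>'. ln (p \<theta>' x)) (at \<theta>) (axis i 1)"

definition fisher_info :: "'x measure \<Rightarrow> (real^'m \<Rightarrow> 'x \<Rightarrow> real) \<Rightarrow> real^'m \<Rightarrow> real^'m^'m" where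
  "fisher_info M p \<theta> = (\<chi> i j. (LINT x | model_measure M p \<theta>. score p \<theta> i x * score p \<theta> j x))"

text \<open>Both conditions are needed because \<open>frechet_derivative\<close> and the Bochner integral are total.
  Almost surely under \<open>p\<^sub>\<theta>\<close> one has \<open>p\<^sub>\<theta>(x) > 0\<close>, so differentiability of \<open>p\<close> in the parameter gives
  that of \<open>log p\<close>.\<close>

definition fisher_info_well_defined ::
    "'x measure \<Rightarrow> (real^'m \<Rightarrow> 'x \<Rightarrow> real) \<Rightarrow> real^'m \<Rightarrow> bool" where
  "fisher_info_well_defined M p \<theta> \<longleftrightarrow>
     (AE x in model_measure M p \<theta>. (\<lambda>\<theta>'. p \<theta>' x) differentiable (at \<theta>)) \<and>
     (\<forall>i j. integrable (model_measure M p \<theta>) (\<lambda>x. score p \<theta> i x * score p \<theta> j x))"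

definition regular_statistical_model ::
    "'x measure \<Rightarrow> (real^'m) set \<Rightarrow> (real^'m \<Rightarrow> 'x \<Rightarrow> real) \<Rightarrow> bool" where
  "regular_statistical_model M \<Theta> p \<longleftrightarrow>
     open \<Theta> \<and> connected \<Theta> \<and>
     (\<forall>\<theta>\<in>\<Theta>. p \<theta> \<in> borel_measurable M \<and> (\<forall>x\<in>space M. 0 \<le> p \<theta> x) \<and>
        prob_space (model_measure M p \<theta>)) \<and>
     (\<forall>\<theta>\<in>\<Theta>. fisher_info_well_defined M p \<theta> \<and> positive_definite (fisher_info M p \<theta>)) \<and>
     smooth_on \<Theta> (fisher_info M p)"

definition fisher_speed ::
    "'x measure \<Rightarrow> (real^'m \<Rightarrow> 'x \<Rightarrow> real) \<Rightarrow> (real \<Rightarrow> real^'m) \<Rightarrow> real \<Rightarrow> real" where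
  "fisher_speed M p c t =
     (let v = vector_derivative c (at t) in sqrt (v \<bullet> (fisher_info M p (c t) *v v)))"

text \<open>\<open>valid_path\<close> means piecewise \<open>C\<^sup>1\<close>, but it lets the derivative blow up at breakpoints. Curves of
  infinite length must be excluded explicitly, as \<open>integral\<close> would assign them length \<open>0\<close>.\<close>

definition fisher_curves ::
    "'x measure \<Rightarrow> (real^'m) set \<Rightarrow> (real^'m \<Rightarrow> 'x \<Rightarrow> real) \<Rightarrow> real^'m \<Rightarrow> real^'m
       \<Rightarrow> (real \<Rightarrow> real^'m) set" where
  "fisher_curves M \<Theta> p a b =
     {c. valid_path c \<and> path_image c \<subseteq> \<Theta> \<and> pathstart c = a \<and> pathfinish c = b \<and>
         fisher_speed M p c integrable_on {0..1}}"

definition fisher_length ::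
    "'x measure \<Rightarrow> (real^'m \<Rightarrow> 'x \<Rightarrow> real) \<Rightarrow> (real \<Rightarrow> real^'m) \<Rightarrow> real" where
  "fisher_length M p c = integral {0..1} (fisher_speed M p c)"

definition fisher_rao ::
    "'x measure \<Rightarrow> (real^'m) set \<Rightarrow> (real^'m \<Rightarrow> 'x \<Rightarrow> real) \<Rightarrow> real^'m \<Rightarrow> real^'m \<Rightarrow> real" where
  "fisher_rao M \<Theta> p a b = (INF c \<in> fisher_curves M \<Theta> p a b. fisher_length M p c)"

text \<open>The metric notion of constant-speed minimizing geodesic. No regularity of \<open>\<gamma>\<close> is required, so
  with \<open>\<rho>\<close> a Riemannian distance it covers every Riemannian one.\<close>

definition constant_speed_minimizing_geodesic ::
    "'a set \<Rightarrow> ('a \<Rightarrow> 'a \<Rightarrow> real) \<Rightarrow> 'a \<Rightarrow> 'a \<Rightarrow> (real \<Rightarrow> 'a) \<Rightarrow> bool" where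
  "constant_speed_minimizing_geodesic \<Theta> \<rho> a b \<gamma> \<longleftrightarrow>
     \<gamma> ` {0..1} \<subseteq> \<Theta> \<and> \<gamma> 0 = a \<and> \<gamma> 1 = b \<and>
     (\<forall>s\<in>{0..1}. \<forall>t\<in>{0..1}. \<rho> (\<gamma> s) (\<gamma> t) = \<bar>s - t\<bar> * \<rho> a b)"

definition tight_at_infinitesimal_scale ::
    "'a::topological_space set \<Rightarrow> ('a \<Rightarrow> 'a \<Rightarrow> real) \<Rightarrow> ('a \<Rightarrow> 'a \<Rightarrow> real) \<Rightarrow> bool" where
  "tight_at_infinitesimal_scale \<Theta> \<rho>L \<rho>U \<longleftrightarrow>
     (\<forall>\<eta>>0. \<forall>\<theta>\<in>\<Theta>. \<exists>U. open U \<and> \<theta> \<in> U \<and>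
        (\<forall>x\<in>U \<inter> \<Theta>. \<forall>y\<in>U \<inter> \<Theta>. x \<noteq> y \<longrightarrow> \<rho>U x y \<le> (1 + \<eta>) * \<rho>L x y))"

text \<open>\<open>\<gamma>\<close> is the geodesic from \<open>a\<close> to \<open>b\<close>; the recursive call receives its first half,
  reparametrized to \<open>[0,1]\<close>. The result is \<open>None\<close> exactly when the recursion does not terminate.\<close>

partial_function (option) ApproxFisherRao ::
    "('a \<Rightarrow> 'a \<Rightarrow> real) \<Rightarrow> ('a \<Rightarrow> 'a \<Rightarrow> real) \<Rightarrow> real \<Rightarrow> 'a \<Rightarrow> 'a \<Rightarrow> (real \<Rightarrow> 'a) \<Rightarrow> real option" where
  "ApproxFisherRao \<rho>L \<rho>U \<epsilon> a b \<gamma> =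
     (if \<rho>U a b > (1 + \<epsilon>) * \<rho>L a b
      then map_option (\<lambda>r. 2 * r) (ApproxFisherRao \<rho>L \<rho>U \<epsilon> a (\<gamma> (1/2)) (\<lambda>t. \<gamma> (t / 2)))
      else Some (\<rho>U a b))"

end

(* The Fisher metric is uniformly positive definite on a closed ball around \<theta>0, so a curve leaving
   the ball has Fisher length bounded below. Hence Fisher-Rao smallness forces Euclidean smallness,
   the points \<gamma>(1/2^n) enter the neighbourhood of \<theta>0 on which the bounds are tight up to 1 + \<epsilon>, and
   the recursion stops there. *)

theory Submission
  imports Defs
begin

section \<open>Lengths of curves leaving a ball\<close>

lemma continuous_on_quadratic_form:
  fixes A :: "'a::topological_space \<Rightarrow> real^'n^'n" and v :: "'a \<Rightarrow> real^'n"
  assumes "continuous_on S A" "continuous_on S v"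
  shows "continuous_on S (\<lambda>x. v x \<bullet> (A x *v v x))"
  unfolding inner_vec_def matrix_vector_mult_def
  using assms by (auto intro!: continuous_intros)

text \<open>By homogeneity it suffices to treat unit vectors. On the compact product of
  \<open>K\<close> with the unit sphere the continuous form \<open>q\<close> attains its minimum,
  which is positive by definiteness; \<open>m\<close> is the square root of that minimum.\<close>

lemma quadratic_form_ge_norm:
  fixes A :: "'a::topological_space \<Rightarrow> real^'n^'n"
  assumes "compact K" "continuous_on K A" "\<And>x. x \<in> K \<Longrightarrow> positive_definite (A x)"
  obtains m where "m > 0" "\<And>x v. x \<in> K \<Longrightarrow> m * norm v \<le> sqrt (v \<bullet> (A x *v v))"
proof (cases "K = {}")
  case True
  then show ?thesis using that[of 1] by simp
next
  case False
  define q where "q = (\<lambda>z. snd z \<bullet> (A (fst z) *v snd z))"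
  have "continuous_on (K \<times> sphere 0 1) (\<lambda>z. A (fst z))"
    by (rule continuous_on_compose2[OF assms(2)]) (auto intro!: continuous_intros)
  then have "continuous_on (K \<times> sphere 0 1) q"
    unfolding q_def by (rule continuous_on_quadratic_form) (auto intro!: continuous_intros)
  moreover have "compact (K \<times> sphere (0 :: real^'n) 1)"
    using assms(1) by (intro compact_Times) auto
  moreover have "K \<times> sphere (0 :: real^'n) 1 \<noteq> {}"
    using False by auto
  ultimately obtain z where z: "z \<in> K \<times> sphere 0 1"
      and min: "\<And>y. y \<in> K \<times> sphere 0 1 \<Longrightarrow> q z \<le> q y"
    using continuous_attains_inf by metis
  have "fst z \<in> K" "snd z \<noteq> 0"
    using z by auto
  then have "q z > 0"
    using assms(3)[of "fst z"] unfolding q_def positive_definite_def by blast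
  moreover have "sqrt (q z) * norm v \<le> sqrt (v \<bullet> (A x *v v))" if x: "x \<in> K" for x v
  proof (cases "v = 0")
    case False
    define u where "u = v /\<^sub>R norm v"
    have v: "v = norm v *\<^sub>R u" and u: "norm u = 1"
      using False by (auto simp: u_def)
    have "q z \<le> q (x, u)"
      using min x u by simp
    then have "(norm v)\<^sup>2 * q z \<le> (norm v)\<^sup>2 * (u \<bullet> (A x *v u))"
      by (simp add: q_def mult_left_mono)
    also have "\<dots> = v \<bullet> (A x *v v)"
      by (subst (2 3) v) (simp add: matrix_vector_mult_scaleR power2_eq_square)
    finally have "sqrt ((norm v)\<^sup>2 * q z) \<le> sqrt (v \<bullet> (A x *v v))"
      by (rule real_sqrt_le_mono)
    then show ?thesis
      by (simp add: real_sqrt_mult mult.commute)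
  qed simp
  ultimately show ?thesis
    using that[of "sqrt (q z)"] by simp
qed

text \<open>\<open>T\<close> is the least time at which the distance from the start equals
  \<open>r\<close>. By the intermediate value theorem, exceeding \<open>r\<close> earlier would
  require an even earlier such time.\<close>

lemma path_first_exit:
  fixes c :: "real \<Rightarrow> 'a::metric_space"
  assumes "path c" and "r > 0" and "r \<le> dist (c 0) (c 1)"
  obtains T where "T \<in> {0..1}" "dist (c 0) (c T) = r" "\<And>s. s \<in> {0..T} \<Longrightarrow> dist (c 0) (c s) \<le> r"
proof -
  define f where "f = (\<lambda>t. dist (c 0) (c t))"
  have cont: "continuous_on {0..1} f"
    using assms(1) unfolding f_def path_def by (intro continuous_intros)
  have hit: "\<exists>t\<in>{0..s}. f t = r" if "s \<in> {0..1}" "r \<le> f s" for s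
  proof -
    have "continuous_on {0..s} f"
      using continuous_on_subset[OF cont] that(1) by auto
    then show ?thesis
      using IVT'[of f 0 r s] that assms(2) by (force simp: f_def)
  qed
  define A where "A = {t \<in> {0..1}. f t = r}"
  have "closed A"
    unfolding A_def by (intro continuous_closed_preimage_constant cont closed_atLeastAtMost)
  then have "compact ({0..1} \<inter> A)"
    by (intro compact_Int_closed compact_Icc)
  moreover have "{0..1} \<inter> A = A"
    by (auto simp: A_def)
  moreover have "A \<noteq> {}"
    using hit[of 1] assms(3) by (auto simp: A_def f_def)
  ultimately obtain T where T: "T \<in> A" "\<And>t. t \<in> A \<Longrightarrow> T \<le> t"
    using compact_attains_inf by metis
  have "f s \<le> r" if s: "s \<in> {0..T}" for s
  proof (rule ccontr)
    assume "\<not> f s \<le> r"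
    moreover have "s \<in> {0..1}"
      using s T(1) by (auto simp: A_def)
    ultimately obtain t where "t \<in> {0..s}" "f t = r"
      using hit[of s] by auto
    then have "t \<in> A"
      using \<open>s \<in> {0..1}\<close> by (auto simp: A_def)
    \<comment> \<open>Minimality of \<open>T\<close> closes the chain
      \<open>T \<le> t \<le> s \<le> T\<close>.\<close>
    then have "t = s"
      using T(2) s \<open>t \<in> {0..s}\<close> by force
    then show False
      using \<open>f t = r\<close> \<open>\<not> f s \<le> r\<close> by simp
  qed
  then show ?thesis
    using that[of T] T(1) by (auto simp: A_def f_def)
qed

text \<open>The derivative may blow up at breakpoints, so the fundamental theorem is used in the
  form that asks for continuity on the closed interval and a derivative only off a finite
  set.\<close>

lemma valid_path_vector_derivative_has_integral:
  fixes c :: "real \<Rightarrow> 'a::banach"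
  assumes "valid_path c" "T \<in> {0..1}"
  shows "((\<lambda>t. vector_derivative c (at t)) has_integral c T - c 0) {0..T}"
proof -
  from assms(1) obtain S where S: "finite S" "c C1_differentiable_on ({0..1} - S)"
    unfolding valid_path_def piecewise_C1_differentiable_on_def by blast
  have "continuous_on {0..1} c"
    using valid_path_imp_path[OF assms(1)] by (simp add: path_def)
  then have "continuous_on {0..T} c"
    using assms(2) by (auto intro: continuous_on_subset)
  moreover have "(c has_vector_derivative vector_derivative c (at t)) (at t)"
    if "t \<in> {0<..<T} - S" for t
    using S(2) that assms(2)
    by (auto simp: C1_differentiable_on_eq vector_derivative_works)
  ultimately show ?thesis
    using assms(2) by (intro fundamental_theorem_of_calculus_interior_strong[OF S(1), of 0 T c]) auto
qed

section \<open>The Fisher-Rao distance controls the Euclidean distance\<close>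

context
  fixes M :: "'x measure" and \<Theta> :: "(real^'m) set" and p :: "real^'m \<Rightarrow> 'x \<Rightarrow> real"
  assumes model: "regular_statistical_model M \<Theta> p"
begin

lemma continuous_on_fisher_info: "continuous_on \<Theta> (fisher_info M p)"
  using model unfolding regular_statistical_model_def smooth_on_def by (metis Ck_on.simps(1))

lemma positive_definite_fisher_info: "\<theta> \<in> \<Theta> \<Longrightarrow> positive_definite (fisher_info M p \<theta>)"
  using model unfolding regular_statistical_model_def by blast

text \<open>Where \<open>c\<close> is not differentiable, \<open>vector_derivative\<close> is some
  unspecified vector, but the form is still nonnegative on it. Breakpoints thus need no separate
  treatment when integrals over nested intervals are compared.\<close>

lemma fisher_speed_nonneg:
  assumes "c t \<in> \<Theta>"
  shows "0 \<le> fisher_speed M p c t"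
  using positive_definite_fisher_info[OF assms] unfolding fisher_speed_def positive_definite_def Let_def
  by (cases "vector_derivative c (at t) = 0") (auto intro: less_imp_le)

text \<open>Without admissible curves the infimum defining \<open>fisher_rao\<close> would be an unspecified real.\<close>

lemma fisher_curves_nonempty:
  assumes "a \<in> \<Theta>" "b \<in> \<Theta>"
  shows "fisher_curves M \<Theta> p a b \<noteq> {}"
proof -
  have "open \<Theta>" "connected \<Theta>"
    using model by (auto simp: regular_statistical_model_def)
  \<comment> \<open>A polynomial path has a continuous derivative, so its Fisher speed is continuous
    and therefore integrable.\<close>
  then obtain c where c: "polynomial_function c" "path_image c \<subseteq> \<Theta>" "pathstart c = a" "pathfinish c = b"
    using connected_open_polynomial_connected assms by metis
  obtain c' where c': "polynomial_function c'" "\<And>t. (c has_vector_derivative c' t) (at t)"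
    using has_vector_derivative_polynomial_function[OF c(1)] by metis
  then have speed: "fisher_speed M p c = (\<lambda>t. sqrt (c' t \<bullet> (fisher_info M p (c t) *v c' t)))"
    by (simp add: fun_eq_iff fisher_speed_def Let_def vector_derivative_at[OF c'(2)])
  have "continuous_on {0..1} (\<lambda>t. fisher_info M p (c t))"
    using c by (intro continuous_on_compose2[OF continuous_on_fisher_info] continuous_on_polymonial_function)
      (auto simp: path_image_def)
  moreover have "continuous_on {0..1} c'"
    using c'(1) by (rule continuous_on_polymonial_function)
  ultimately have "continuous_on {0..1} (fisher_speed M p c)"
    unfolding speed by (intro continuous_on_real_sqrt continuous_on_quadratic_form)
  then have "fisher_speed M p c integrable_on {0..1}"
    by (rule integrable_continuous_real)
  moreover have "c C1_differentiable_on {0..1}"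
    using c' continuous_on_polymonial_function by (auto simp: C1_differentiable_on_def)
  then have "valid_path c"
    by (simp add: valid_path_def C1_differentiable_imp_piecewise)
  ultimately have "c \<in> fisher_curves M \<Theta> p a b"
    using c by (simp add: fisher_curves_def)
  then show ?thesis by blast
qed

text \<open>Until the first exit from the ball, the Fisher speed dominates \<open>m\<close> times
  the Euclidean speed, whose integral is at least the displacement \<open>r\<close>. The rest of the
  curve adds a nonnegative amount.\<close>

lemma fisher_length_exit_ge:
  assumes "\<And>\<theta> v. \<theta> \<in> cball a r \<Longrightarrow> m * norm v \<le> sqrt (v \<bullet> (fisher_info M p \<theta> *v v))"
    and "m \<ge> 0" "c \<in> fisher_curves M \<Theta> p a b" "r > 0" "r \<le> dist a b"
  shows "m * r \<le> fisher_length M p c"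
proof -
  let ?v = "\<lambda>t. vector_derivative c (at t)"
  have c: "valid_path c" "path_image c \<subseteq> \<Theta>" "c 0 = a" "c 1 = b"
      and speed: "fisher_speed M p c integrable_on {0..1}"
    using assms(3) by (auto simp: fisher_curves_def pathstart_def pathfinish_def)
  obtain T where T: "T \<in> {0..1}" "dist a (c T) = r" "\<And>s. s \<in> {0..T} \<Longrightarrow> dist a (c s) \<le> r"
    using path_first_exit[of c r] valid_path_imp_path[OF c(1)] assms(4,5) c(3,4) by metis
  have speed_T: "fisher_speed M p c integrable_on {0..T}"
    using integrable_subinterval_real[OF speed] T(1) by auto
  have has: "((\<lambda>t. m *\<^sub>R ?v t) has_integral m *\<^sub>R (c T - c 0)) {0..T}"
    by (intro has_integral_cmul valid_path_vector_derivative_has_integral c(1) T(1))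
  have "m * r = norm (integral {0..T} (\<lambda>t. m *\<^sub>R ?v t))"
    unfolding integral_unique[OF has] using T(2) assms(2) c(3)
    by (simp add: dist_norm norm_minus_commute)
  also have "\<dots> \<le> integral {0..T} (fisher_speed M p c)"
    using has speed_T T(3) assms(1,2)
    by (intro integral_norm_bound_integral) (auto simp: fisher_speed_def Let_def)
  also have "\<dots> \<le> integral {0..1} (fisher_speed M p c)"
    using speed speed_T T(1) c(2)
    by (intro integral_subset_le) (auto intro!: fisher_speed_nonneg simp: path_image_def)
  finally show ?thesis
    by (simp add: fisher_length_def)
qed

text \<open>This direction of the comparison of topologies turns short Fisher-Rao distances along
  the geodesic into membership in a Euclidean neighbourhood, as tightness requires.\<close>

lemma fisher_rao_lt_imp_dist_lt:
  assumes "a \<in> \<Theta>" "e > 0"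
  obtains \<delta> where "\<delta> > 0" "\<And>b. b \<in> \<Theta> \<Longrightarrow> fisher_rao M \<Theta> p a b < \<delta> \<Longrightarrow> dist a b < e"
proof -
  have "open \<Theta>"
    using model by (auto simp: regular_statistical_model_def)
  then obtain r0 where r0: "r0 > 0" "cball a r0 \<subseteq> \<Theta>"
    using assms(1) open_contains_cball by metis
  \<comment> \<open>The bound \<open>r0\<close> keeps the closed ball inside
    \<open>\<Theta>\<close>, where the metric is uniformly definite; the bound \<open>e\<close>
    gives the desired conclusion.\<close>
  define r where "r = min r0 e"
  have r: "r > 0" "r \<le> e" "cball a r \<subseteq> \<Theta>"
    using r0 assms(2) by (auto simp: r_def)
  obtain m where m: "m > 0"
      "\<And>\<theta> v. \<theta> \<in> cball a r \<Longrightarrow> m * norm v \<le> sqrt (v \<bullet> (fisher_info M p \<theta> *v v))"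
    using quadratic_form_ge_norm[OF compact_cball continuous_on_subset[OF continuous_on_fisher_info r(3)]]
      positive_definite_fisher_info r(3) by blast
  have "m * r \<le> fisher_rao M \<Theta> p a b" if "b \<in> \<Theta>" "r \<le> dist a b" for b
    unfolding fisher_rao_def
    using fisher_curves_nonempty[OF assms(1) that(1)] fisher_length_exit_ge[OF m(2) less_imp_le[OF m(1)] _ r(1) that(2)]
    by (intro cINF_greatest)
  \<comment> \<open>With \<open>\<delta> = m * r\<close>, a distance below \<open>\<delta>\<close>
    excludes \<open>r \<le> dist a b\<close>.\<close>
  then show ?thesis
    using that[of "m * r"] m(1) r(1,2) by (smt (verit) mult_pos_pos)
qed

text \<open>Taking \<open>e = dist a b\<close> above, a Fisher-Rao distance below
  \<open>\<delta>\<close> would give \<open>dist a b < dist a b\<close>.\<close>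

lemma fisher_rao_pos:
  assumes "a \<in> \<Theta>" "b \<in> \<Theta>" "a \<noteq> b"
  shows "fisher_rao M \<Theta> p a b > 0"
proof -
  have "dist a b > 0"
    using assms(3) by simp
  then obtain \<delta> where "\<delta> > 0" "\<And>b'. b' \<in> \<Theta> \<Longrightarrow> fisher_rao M \<Theta> p a b' < \<delta> \<Longrightarrow> dist a b' < dist a b"
    using fisher_rao_lt_imp_dist_lt[OF assms(1)] by blast
  then show ?thesis
    using assms(2) by (smt (verit))
qed

end

section \<open>The recursion\<close>

lemma constant_speed_minimizing_geodesic_dist:
  assumes "constant_speed_minimizing_geodesic \<Theta> \<rho> a b \<gamma>" "s \<in> {0..1}" "t \<in> {0..1}"
  shows "\<rho> (\<gamma> s) (\<gamma> t) = \<bar>s - t\<bar> * \<rho> a b"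
  using assms unfolding constant_speed_minimizing_geodesic_def by blast

lemma constant_speed_minimizing_geodesic_dist_start:
  assumes "constant_speed_minimizing_geodesic \<Theta> \<rho> a b \<gamma>" "t \<in> {0..1}"
  shows "\<rho> a (\<gamma> t) = t * \<rho> a b"
proof -
  have "\<gamma> 0 = a"
    using assms(1) unfolding constant_speed_minimizing_geodesic_def by blast
  then show ?thesis
    using constant_speed_minimizing_geodesic_dist[OF assms(1), of 0 t] assms(2) by simp
qed

lemma constant_speed_minimizing_geodesic_half:
  assumes "constant_speed_minimizing_geodesic \<Theta> \<rho> a b \<gamma>"
  shows "constant_speed_minimizing_geodesic \<Theta> \<rho> a (\<gamma> (1/2)) (\<lambda>t. \<gamma> (t/2))"
  unfolding constant_speed_minimizing_geodesic_def
proof (intro conjI ballI)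
  have "\<gamma> ` {0..1} \<subseteq> \<Theta>" and start: "\<gamma> 0 = a"
    using assms by (simp_all add: constant_speed_minimizing_geodesic_def)
  then show "(\<lambda>t. \<gamma> (t/2)) ` {0..1} \<subseteq> \<Theta>"
    by (auto simp: image_subset_iff)
  show "\<gamma> (0/2) = a"
    using start by simp
  fix s t :: real
  assume "s \<in> {0..1}" "t \<in> {0..1}"
  then have "\<rho> (\<gamma> (s/2)) (\<gamma> (t/2)) = \<bar>s/2 - t/2\<bar> * \<rho> a b"
    by (intro constant_speed_minimizing_geodesic_dist[OF assms]) auto
  also have "\<rho> a b = 2 * \<rho> a (\<gamma> (1/2))"
    using constant_speed_minimizing_geodesic_dist_start[OF assms, of "1/2"] by simp
  finally show "\<rho> (\<gamma> (s/2)) (\<gamma> (t/2)) = \<bar>s - t\<bar> * \<rho> a (\<gamma> (1/2))"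
    by (simp flip: diff_divide_distrib)
qed simp

text \<open>The last hypothesis makes the stopping test succeed at depth \<open>n\<close> at the
  latest. At any stop, \<rho>U is at most (1 + \<epsilon>) \<rho>L and hence at most (1 +
  \<epsilon>) \<rho>. Each doubling on the way back preserves the estimate because the first half
  has exactly half the length.\<close>

lemma ApproxFisherRao_correct:
  assumes "constant_speed_minimizing_geodesic \<Theta> \<rho> a b \<gamma>"
    and "\<And>x. x \<in> \<Theta> \<Longrightarrow> \<rho>L a x \<le> \<rho> a x \<and> \<rho> a x \<le> \<rho>U a x"
    and "\<epsilon> \<ge> 0"
    and "\<rho>U a (\<gamma> (1/2^n)) \<le> (1 + \<epsilon>) * \<rho>L a (\<gamma> (1/2^n))"
  shows "\<exists>r. ApproxFisherRao \<rho>L \<rho>U \<epsilon> a b \<gamma> = Some r \<and> \<rho> a b \<le> r \<and> r \<le> (1 + \<epsilon>) * \<rho> a b"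
proof -
  have stop: "\<exists>r. ApproxFisherRao \<rho>L \<rho>U \<epsilon> a b \<gamma> = Some r \<and> \<rho> a b \<le> r \<and> r \<le> (1 + \<epsilon>) * \<rho> a b"
    if geo: "constant_speed_minimizing_geodesic \<Theta> \<rho> a b \<gamma>" and le: "\<rho>U a b \<le> (1 + \<epsilon>) * \<rho>L a b"
    for b \<gamma>
  proof -
    have "b \<in> \<Theta>"
      using geo by (force simp: constant_speed_minimizing_geodesic_def)
    note bounds = assms(2)[OF this]
    have "(1 + \<epsilon>) * \<rho>L a b \<le> (1 + \<epsilon>) * \<rho> a b"
      using bounds assms(3) by (intro mult_left_mono) auto
    then have "\<rho>U a b \<le> (1 + \<epsilon>) * \<rho> a b"
      using le by linarith
    then show ?thesis
      using le bounds by (subst ApproxFisherRao.simps) simp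
  qed
  show ?thesis
    using assms(1,4)
  proof (induction n arbitrary: b \<gamma>)
    case 0
    then have "\<gamma> 1 = b"
      by (simp add: constant_speed_minimizing_geodesic_def)
    then show ?case
      using stop 0 by simp
  next
    case (Suc n)
    note geo = Suc.prems(1)
    show ?case
    proof (cases "\<rho>U a b > (1 + \<epsilon>) * \<rho>L a b")
      case True
      have "\<exists>r. ApproxFisherRao \<rho>L \<rho>U \<epsilon> a (\<gamma> (1/2)) (\<lambda>t. \<gamma> (t/2)) = Some r \<and>
          \<rho> a (\<gamma> (1/2)) \<le> r \<and> r \<le> (1 + \<epsilon>) * \<rho> a (\<gamma> (1/2))"
        \<comment> \<open>The half geodesic evaluated at \<open>1/2^n\<close> is
          \<open>\<gamma>\<close> at \<open>1/2^(Suc n)\<close>.\<close>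
        using Suc.prems(2)
        by (intro Suc.IH constant_speed_minimizing_geodesic_half[OF geo]) (simp add: mult.commute)
      moreover have "\<rho> a (\<gamma> (1/2)) = \<rho> a b / 2"
        using constant_speed_minimizing_geodesic_dist_start[OF geo, of "1/2"] by simp
      ultimately show ?thesis
        using True by (subst ApproxFisherRao.simps) auto
    next
      case False
      then show ?thesis
        using stop[OF geo] by simp
    qed
  qed
qed

theorem mainTheorem8:
  fixes M :: "'x measure"
    and \<Theta> :: "(real^'m) set"
    and p :: "real^'m \<Rightarrow> 'x \<Rightarrow> real"
    and \<theta>0 \<theta>1 :: "real^'m"
    and \<gamma> :: "real \<Rightarrow> real^'m"
    and \<rho>L \<rho>U :: "real^'m \<Rightarrow> real^'m \<Rightarrow> real"
    and \<epsilon> :: real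
  assumes "regular_statistical_model M \<Theta> p"
    and "\<theta>0 \<in> \<Theta>" and "\<theta>1 \<in> \<Theta>" and "\<theta>0 \<noteq> \<theta>1"
    and "constant_speed_minimizing_geodesic \<Theta> (fisher_rao M \<Theta> p) \<theta>0 \<theta>1 \<gamma>"
    and "\<And>\<theta> \<theta>'. \<theta> \<in> \<Theta> \<Longrightarrow> \<theta>' \<in> \<Theta> \<Longrightarrow> 0 \<le> \<rho>L \<theta> \<theta>' \<and> 0 \<le> \<rho>U \<theta> \<theta>'"
    and "\<And>\<theta> \<theta>'. \<theta> \<in> \<Theta> \<Longrightarrow> \<theta>' \<in> \<Theta> \<Longrightarrow>
           \<rho>L \<theta> \<theta>' \<le> fisher_rao M \<Theta> p \<theta> \<theta>' \<and> fisher_rao M \<Theta> p \<theta> \<theta>' \<le> \<rho>U \<theta> \<theta>'"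
    and "tight_at_infinitesimal_scale \<Theta> \<rho>L \<rho>U"
    and "\<epsilon> > 0"
  shows "\<exists>r. ApproxFisherRao \<rho>L \<rho>U \<epsilon> \<theta>0 \<theta>1 \<gamma> = Some r \<and>
           fisher_rao M \<Theta> p \<theta>0 \<theta>1 \<le> r \<and> r \<le> (1 + \<epsilon>) * fisher_rao M \<Theta> p \<theta>0 \<theta>1"
proof -
  let ?\<rho> = "fisher_rao M \<Theta> p"
  have pos: "?\<rho> \<theta>0 \<theta>1 > 0"
    using fisher_rao_pos assms(1-4) by blast
  \<comment> \<open>Tightness is used at \<open>\<theta>0\<close> with tolerance
    \<open>\<epsilon>\<close>.\<close>
  obtain U where U: "open U" "\<theta>0 \<in> U"
      "\<And>x y. x \<in> U \<inter> \<Theta> \<Longrightarrow> y \<in> U \<inter> \<Theta> \<Longrightarrow> x \<noteq> y \<Longrightarrow> \<rho>U x y \<le> (1 + \<epsilon>) * \<rho>L x y"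
    using assms(2,8,9) unfolding tight_at_infinitesimal_scale_def by metis
  obtain e where e: "e > 0" "ball \<theta>0 e \<subseteq> U"
    using U(1,2) open_contains_ball by metis
  obtain \<delta> where \<delta>: "\<delta> > 0" "\<And>b. b \<in> \<Theta> \<Longrightarrow> ?\<rho> \<theta>0 b < \<delta> \<Longrightarrow> dist \<theta>0 b < e"
    using fisher_rao_lt_imp_dist_lt[OF assms(1,2) e(1)] by blast
  \<comment> \<open>After \<open>n\<close> halvings the distance from \<open>\<theta>0\<close> is
    \<open>?\<rho> \<theta>0 \<theta>1 / 2^n\<close>, which this choice puts below
    \<open>\<delta>\<close>.\<close>
  obtain n where n: "(1/2)^n < \<delta> / ?\<rho> \<theta>0 \<theta>1"
    using real_arch_pow_inv[of "\<delta> / ?\<rho> \<theta>0 \<theta>1" "1/2"] pos \<delta>(1) by auto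
  define x where "x = \<gamma> (1/2^n)"
  have x: "x \<in> \<Theta>"
    using assms(5) by (auto simp: x_def constant_speed_minimizing_geodesic_def image_subset_iff)
  have dist_x: "?\<rho> \<theta>0 x = 1/2^n * ?\<rho> \<theta>0 \<theta>1"
    unfolding x_def by (intro constant_speed_minimizing_geodesic_dist_start[OF assms(5)]) auto
  have "?\<rho> \<theta>0 x < \<delta>"
    using n pos dist_x by (simp add: power_divide pos_less_divide_eq)
  then have "x \<in> U"
    using \<delta>(2)[OF x] e(2) by auto
  \<comment> \<open>Tightness speaks only of distinct points. The geodesic at time 0 gives
    \<open>?\<rho> \<theta>0 \<theta>0 = 0\<close>, whereas \<open>?\<rho> \<theta>0 x\<close> is
    positive.\<close>
  moreover have "?\<rho> \<theta>0 (\<gamma> 0) = 0" "\<gamma> 0 = \<theta>0"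
    using constant_speed_minimizing_geodesic_dist_start[OF assms(5), of 0] assms(5)
    by (simp, simp add: constant_speed_minimizing_geodesic_def)
  then have "x \<noteq> \<theta>0"
    using dist_x pos by auto
  ultimately have "\<rho>U \<theta>0 x \<le> (1 + \<epsilon>) * \<rho>L \<theta>0 x"
    using U(2,3) x assms(2) by auto
  then show ?thesis
    using assms(2,7,9) unfolding x_def by (intro ApproxFisherRao_correct[OF assms(5)]) auto
qed

end
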